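(* Let $X_1, X_2, \ldots$ be a sequence of independent, identically distributed real random variables with a continuous distribution function $F$. For each $i\ge 1$ let $R_i$ be the sequential rank of $X_i$, let $P_i=\frac{R_i-0.5}{i}$, and let $Z_i=\Phi^{-1}(P_i)$. Then: (1) for every $n\ge 1$, the random variables $P_1,\ldots,P_n$ are mutually independent; (2) for every $n\ge 1$, the random variables $Z_1,\ldots,Z_n$ are mutually independent, and they are asymptotically standard normal, i.e. $Z_i$ converges in distribution to the standard normal distribution $N(0,1)$ as $i\to\infty$.
   Context: The sequential rank $R_i$ of $X_i$ is the rank of $X_i$ among $X_1,\ldots,X_i$, that is, $R_1=1$ and, for $i\ge 2$, $R_i=1+\sum_{j=1}^{i-1} I(X_j\le X_i)$, where $I(\cdot)$ denotes the indicator of an event (ties occur with probability zero because $F$ is continuous). $\Phi$ denotes the standard normal cumulative distribution function and $\Phi^{-1}:(0,1)\to\mathbb{R}$ its inverse. The $Z_i$ are called sequential normal scores. *)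

theory Defs
  imports "HOL-Probability.Probability"
begin

definition std_normal_cdf :: "real \<Rightarrow> real" where
  "std_normal_cdf = cdf std_normal_distribution"

text \<open>
  The standard normal cdf is a bijection from the reals onto the open unit interval.  So the
  value below is the usual quantile for \<open>0 < p < 1\<close> and is unspecified for other \<open>p\<close>.
\<close>

definition std_normal_quantile :: "real \<Rightarrow> real" where
  "std_normal_quantile p = inv std_normal_cdf p"

text \<open>
  Sequences are indexed from 1.  The values of the three functions below at index 0 carry no
  meaning.
\<close>

definition seq_rank :: "(nat \<Rightarrow> 'a \<Rightarrow> real) \<Rightarrow> nat \<Rightarrow> 'a \<Rightarrow> nat" where
  "seq_rank X i \<omega> = 1 + (\<Sum>j = 1..<i. of_bool (X j \<omega> \<le> X i \<omega>))"

definition rank_score :: "(nat \<Rightarrow> 'a \<Rightarrow> real) \<Rightarrow> nat \<Rightarrow> 'a \<Rightarrow> real" where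
  "rank_score X i \<omega> = (real (seq_rank X i \<omega>) - 1 / 2) / real i"

definition seq_normal_score :: "(nat \<Rightarrow> 'a \<Rightarrow> real) \<Rightarrow> nat \<Rightarrow> 'a \<Rightarrow> real" where
  "seq_normal_score X i \<omega> = std_normal_quantile (rank_score X i \<omega>)"

end

theory Submission
  imports Defs
begin

text \<open>
  Sequential ranks determine the order pattern of a vector without ties, and there are as many
  rank vectors in \<open>{1} \<times> {1,2} \<times> \<dots> \<times> {1..n}\<close> as permutations of \<open>{1..n}\<close>, so
  patterns and rank vectors correspond bijectively.  Ties have probability zero and all patterns
  are equally likely by exchangeability, so the rank vector is uniform on this product, and hence
  its coordinates are independent and uniform.  For the limit, \<open>Z\<^sub>i \<le> x\<close> holds iff
  \<open>P\<^sub>i \<le> \<Phi>(x)\<close>, and \<open>P\<^sub>i\<close> is uniform on the midpoints of the \<open>i\<close> equal subintervals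
  of the unit interval.
\<close>

section \<open>Sequential ranks and order patterns\<close>

text \<open>The codomain is an arbitrary linear order, so that sample paths (real values) and
  permutations (natural values) share one notion of rank and can be compared.\<close>

definition rank_in :: "(nat \<Rightarrow> 'b::linorder) \<Rightarrow> nat \<Rightarrow> nat" where
  "rank_in f i = Suc (card {j \<in> {1..<i}. f j \<le> f i})"

lemma seq_rank_eq_rank_in: "seq_rank X i \<omega> = rank_in (\<lambda>j. X j \<omega>) i"
  by (simp add: seq_rank_def rank_in_def Int_def flip: of_bool_def)

lemma rank_in_mem:
  assumes "1 \<le> i"
  shows "rank_in f i \<in> {1..i}"
proof -
  have "card {j \<in> {1..<i}. f j \<le> f i} \<le> card {1..<i}"
    by (intro card_mono) auto
  with assms show ?thesis by (simp add: rank_in_def)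
qed

lemma rank_in_cong:
  assumes "\<And>i j. \<lbrakk>i \<in> {1..n}; j \<in> {1..n}\<rbrakk> \<Longrightarrow> f i \<le> f j \<longleftrightarrow> g i \<le> g j" and "i \<in> {1..n}"
  shows "rank_in f i = rank_in g i"
proof -
  have "{j \<in> {1..<i}. f j \<le> f i} = {j \<in> {1..<i}. g j \<le> g i}"
    using assms by auto
  then show ?thesis by (simp add: rank_in_def)
qed

text \<open>Induction on \<open>n\<close>: the earlier ranks fix the pattern of the first
  \<open>n\<close> entries, and the last rank counts how many of these lie below the new entry,
  which fixes its place among them.\<close>

lemma same_pattern_if_rank_in_eq:
  fixes f :: "nat \<Rightarrow> 'b::linorder" and g :: "nat \<Rightarrow> 'c::linorder"
  assumes "inj_on f {1..n}" "inj_on g {1..n}"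
    and "\<And>i. i \<in> {1..n} \<Longrightarrow> rank_in f i = rank_in g i"
    and "i \<in> {1..n}" "j \<in> {1..n}"
  shows "f i \<le> f j \<longleftrightarrow> g i \<le> g j"
  using assms
proof (induction n arbitrary: i j)
  case 0
  then show ?case by simp
next
  case (Suc n)
  let ?A = "{j \<in> {1..<Suc n}. f j \<le> f (Suc n)}" and ?B = "{j \<in> {1..<Suc n}. g j \<le> g (Suc n)}"
  have "inj_on f {1..n}" "inj_on g {1..n}"
    using Suc.prems(1,2) by (auto intro: inj_on_subset)
  then have IH: "f i \<le> f j \<longleftrightarrow> g i \<le> g j" if "i \<in> {1..n}" "j \<in> {1..n}" for i j
    using Suc.IH Suc.prems(3) that by auto
  \<comment> \<open>Both sets are initial segments of \<open>{1..n}\<close> in the same order, so one contains the other.\<close>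
  have "?A \<subseteq> ?B \<or> ?B \<subseteq> ?A"
  proof (rule ccontr)
    assume "\<not> ?thesis"
    then obtain a b where "a \<in> ?A" "a \<notin> ?B" "b \<in> ?B" "b \<notin> ?A"
      by blast
    then have ab: "a \<in> {1..n}" "b \<in> {1..n}" "f a < f b" "g b < g a"
      by auto
    then show False
      using IH[of b a] by auto
  qed
  moreover have "card ?A = card ?B"
    using Suc.prems(3)[of "Suc n"] by (simp add: rank_in_def)
  moreover have "finite ?A" "finite ?B"
    by auto
  ultimately have "?A = ?B"
    using card_subset_eq[of ?A ?B] card_subset_eq[of ?B ?A] by argo
  then have "j \<in> ?A \<longleftrightarrow> j \<in> ?B" for j
    by (rule arg_cong)
  then have 1: "f j \<le> f (Suc n) \<longleftrightarrow> g j \<le> g (Suc n)" if "j \<in> {1..n}" for j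
    using that unfolding mem_Collect_eq by (meson atLeastAtMost_iff atLeastLessThan_iff le_imp_less_Suc)
  \<comment> \<open>Without ties, this comparison is the negation of the one in
    \<open>1\<close>.\<close>
  have 2: "f (Suc n) \<le> f j \<longleftrightarrow> g (Suc n) \<le> g j" if "j \<in> {1..n}" for j
  proof -
    have "f (Suc n) \<noteq> f j" "g (Suc n) \<noteq> g j"
      using that inj_onD[OF Suc.prems(1), of "Suc n" j] inj_onD[OF Suc.prems(2), of "Suc n" j]
      by auto
    then show ?thesis
      using 1[OF that] by auto
  qed
  show ?case
    using Suc.prems(4,5) IH 1 2 by (cases "i = Suc n"; cases "j = Suc n") auto
qed

text \<open>A permutation can be read off its pattern: its value at \<open>i\<close> is the number
  of \<open>j\<close> in \<open>{1..n}\<close> whose value does not exceed the value at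
  \<open>i\<close>.\<close>

lemma permutes_eq_if_same_pattern:
  fixes p q :: "nat \<Rightarrow> nat"
  assumes p: "p permutes {1..n}" and q: "q permutes {1..n}"
    and pat: "\<And>i j. \<lbrakk>i \<in> {1..n}; j \<in> {1..n}\<rbrakk> \<Longrightarrow> p i \<le> p j \<longleftrightarrow> q i \<le> q j"
  shows "p = q"
proof
  fix i
  have count: "card {j \<in> {1..n}. s j \<le> s i} = s i" if s: "s permutes {1..n}" and i: "i \<in> {1..n}"
    for s :: "nat \<Rightarrow> nat"
  proof -
    have "s ` {j \<in> {1..n}. s j \<le> s i} = {k \<in> s ` {1..n}. k \<le> s i}"
      by auto
    also have "\<dots> = {1..s i}"
      using permutes_image[OF s] permutes_in_image[OF s, of i] i by auto
    finally have "card (s ` {j \<in> {1..n}. s j \<le> s i}) = s i"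
      by simp
    then show ?thesis
      using card_image[OF inj_on_subset[OF permutes_inj[OF s] subset_UNIV]] by metis
  qed
  show "p i = q i"
  proof (cases "i \<in> {1..n}")
    case True
    then have "{j \<in> {1..n}. p j \<le> p i} = {j \<in> {1..n}. q j \<le> q i}"
      using pat by auto
    then show ?thesis
      using count[OF p True] count[OF q True] by metis
  next
    case False
    then show ?thesis
      using p q by (simp add: permutes_not_in)
  qed
qed

text \<open>Surjectivity by counting: the map from permutations to rank vectors is injective by the
  two preceding lemmas, and its domain and the product both have \<open>fact n\<close>
  elements.\<close>

lemma ex_permutation_with_ranks:
  assumes "r \<in> (\<Pi>\<^sub>E i\<in>{1..n}. {1..i})"
  obtains p where "p permutes {1..n}" "\<And>i. i \<in> {1..n} \<Longrightarrow> rank_in p i = r i"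
proof -
  let ?P = "{p. p permutes {1..n}}" and ?R = "\<lambda>p. restrict (rank_in p) {1..n}"
  have "inj_on ?R ?P"
  proof (intro inj_onI permutes_eq_if_same_pattern)
    fix p q i j
    assume *: "p \<in> ?P" "q \<in> ?P" "?R p = ?R q" "i \<in> {1..n}" "j \<in> {1..n}"
    have "rank_in p i = rank_in q i" if "i \<in> {1..n}" for i
      using fun_cong[OF *(3), of i] that by simp
    then show "p i \<le> p j \<longleftrightarrow> q i \<le> q j"
      using * by (intro same_pattern_if_rank_in_eq[of p n q]) (auto intro: permutes_inj_on)
  qed auto
  then have "card (?R ` ?P) = fact n"
    by (simp add: card_image card_permutations)
  moreover have "card (\<Pi>\<^sub>E i\<in>{1..n}. {1..i}) = fact n"
    by (simp add: card_PiE fact_prod)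
  moreover have "?R ` ?P \<subseteq> (\<Pi>\<^sub>E i\<in>{1..n}. {1..i})"
    using rank_in_mem by (fastforce simp: PiE_iff)
  ultimately have "?R ` ?P = (\<Pi>\<^sub>E i\<in>{1..n}. {1..i})"
    by (intro card_subset_eq) (auto intro: finite_PiE)
  with assms have "r \<in> ?R ` ?P"
    by argo
  then obtain p where "p permutes {1..n}" "r = ?R p"
    by blast
  then show ?thesis
    using that by auto
qed

section \<open>Joint law of the sequential ranks\<close>

text \<open>Applied both to events of the sample space and to sets of vectors in the product
  space.\<close>

lemma pred_order_pattern:
  fixes Y :: "'i \<Rightarrow> 'a \<Rightarrow> real"
  assumes "finite I" "\<And>i. i \<in> I \<Longrightarrow> Y i \<in> borel_measurable N"
  shows "{\<omega> \<in> space N. \<forall>i\<in>I. \<forall>j\<in>I. Y i \<omega> \<le> Y j \<omega> \<longleftrightarrow> R i j} \<in> sets N"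
proof (intro sets.sets_Collect_finite_All assms(1))
  fix i j assume ij: "i \<in> I" "j \<in> I"
  have [measurable]: "Y i \<in> borel_measurable N" "Y j \<in> borel_measurable N"
    using ij assms(2) by auto
  show "{\<omega> \<in> space N. Y i \<omega> \<le> Y j \<omega> \<longleftrightarrow> R i j} \<in> sets N"
    by (cases "R i j") simp_all
qed

text \<open>Continuity of the distribution function enters as the absence of atoms. It is stated for
  \<open>X 1\<close>; \<open>ident\<close> carries it to every other index.\<close>

locale iid_atomless = prob_space M for M :: "'a measure" +
  fixes X :: "nat \<Rightarrow> 'a \<Rightarrow> real"
  assumes indep: "indep_vars (\<lambda>_. borel) X {1..}"
    and ident: "1 \<le> i \<Longrightarrow> distr M borel (X i) = distr M borel (X 1)"
    and atomless: "measure (distr M borel (X 1)) {x} = 0"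
begin

lemma X_measurable: "1 \<le> i \<Longrightarrow> X i \<in> borel_measurable M"
  using indep unfolding indep_vars_def by auto

lemma rank_in_measurable:
  assumes "1 \<le> i"
  shows "(\<lambda>\<omega>. rank_in (\<lambda>j. X j \<omega>) i) \<in> M \<rightarrow>\<^sub>M count_space UNIV"
proof -
  have [measurable]: "(\<lambda>\<omega>. X j \<omega> \<le> X i \<omega>) \<in> M \<rightarrow>\<^sub>M count_space UNIV" if "j \<in> {1..<i}" for j
    using X_measurable[of i] X_measurable[of j] assms that by auto
  have "(\<lambda>\<omega>. \<Sum>j = 1..<i. of_bool (X j \<omega> \<le> X i \<omega>) :: nat) \<in> M \<rightarrow>\<^sub>M count_space UNIV"
    by measurable
  then have "(\<lambda>\<omega>. 1 + (\<Sum>j = 1..<i. of_bool (X j \<omega> \<le> X i \<omega>)) :: nat) \<in> M \<rightarrow>\<^sub>M count_space UNIV"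
    by measurable
  then show ?thesis
    by (simp flip: seq_rank_eq_rank_in add: seq_rank_def)
qed

text \<open>By independence the pair has a product law, and by Fubini the diagonal is null because
  each of its sections is a single point, which is not an atom.\<close>

lemma AE_no_tie:
  assumes "1 \<le> i" "1 \<le> j" "i \<noteq> j"
  shows "AE \<omega> in M. X i \<omega> \<noteq> X j \<omega>"
proof -
  let ?D = "distr M borel (X 1)"
  have [measurable]: "X i \<in> borel_measurable M" "X j \<in> borel_measurable M" "X 1 \<in> borel_measurable M"
    by (rule X_measurable[OF assms(1)] X_measurable[OF assms(2)] X_measurable[OF order_refl])+
  interpret D: prob_space ?D by (rule prob_space_distr) fact
  interpret DD: pair_prob_space ?D ?D ..
  \<comment> \<open>Pairwise independence comes from the family: restrict it to the disjoint index
    sets \<open>{i}\<close> and \<open>{j}\<close>, then project each restriction to its only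
    coordinate.\<close>
  have "indep_var borel (X i) borel (X j)"
  proof -
    have "indep_var (PiM {i} (\<lambda>_. borel)) (\<lambda>\<omega>. restrict (\<lambda>i. X i \<omega>) {i})
        (PiM {j} (\<lambda>_. borel)) (\<lambda>\<omega>. restrict (\<lambda>i. X i \<omega>) {j})"
      using assms by (intro indep_var_restrict[OF indep]) auto
    then have "indep_var borel ((\<lambda>f. f i) \<circ> (\<lambda>\<omega>. restrict (\<lambda>i. X i \<omega>) {i}))
        borel ((\<lambda>f. f j) \<circ> (\<lambda>\<omega>. restrict (\<lambda>i. X i \<omega>) {j}))"
      by (rule indep_var_compose) auto
    then show ?thesis
      by (simp add: comp_def)
  qed
  then have eq: "distr M (borel \<Otimes>\<^sub>M borel) (\<lambda>\<omega>. (X i \<omega>, X j \<omega>)) = ?D \<Otimes>\<^sub>M ?D"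
    using ident[OF assms(1)] ident[OF assms(2)] by (simp add: indep_var_distribution_eq)
  have "AE x in ?D. AE y in ?D. x \<noteq> y"
  proof (rule AE_I2)
    fix x
    have "emeasure ?D {x} = 0"
      using atomless[of x] by (simp add: D.emeasure_eq_measure del: One_nat_def)
    then show "AE y in ?D. x \<noteq> y"
      by (intro AE_I[of _ _ "{x}"]) auto
  qed
  moreover have pair: "(\<lambda>\<omega>. (X i \<omega>, X j \<omega>)) \<in> M \<rightarrow>\<^sub>M borel \<Otimes>\<^sub>M borel"
    by measurable
  moreover have off_diag: "{z \<in> space (borel \<Otimes>\<^sub>M borel). fst z \<noteq> snd z}
      \<in> sets (borel \<Otimes>\<^sub>M borel :: (real \<times> real) measure)"
    by measurable
  moreover have sets: "sets (?D \<Otimes>\<^sub>M ?D) = sets (borel \<Otimes>\<^sub>M borel)"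
    by (intro sets_pair_measure_cong sets_distr)
  ultimately have "AE z in ?D \<Otimes>\<^sub>M ?D. fst z \<noteq> snd z"
    unfolding sets[symmetric] sets_eq_imp_space_eq[OF sets, symmetric]
    by (intro DD.AE_pair_measure) (assumption, simp only: fst_conv snd_conv)
  then have "AE z in distr M (borel \<Otimes>\<^sub>M borel) (\<lambda>\<omega>. (X i \<omega>, X j \<omega>)). fst z \<noteq> snd z"
    by (simp only: eq)
  then show ?thesis
    by (simp only: AE_distr_iff[OF pair off_diag] fst_conv snd_conv)
qed

lemma AE_inj: "AE \<omega> in M. inj_on (\<lambda>i. X i \<omega>) {1..n}"
proof -
  have "AE \<omega> in M. \<forall>i\<in>{1..n}. \<forall>j\<in>{1..n}. i \<noteq> j \<longrightarrow> X i \<omega> \<noteq> X j \<omega>"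
    using AE_no_tie by (intro AE_finite_allI) auto
  then show ?thesis
    by eventually_elim (auto simp: inj_on_def)
qed

text \<open>Exchangeability: the joint law is a product of identical factors, and reindexing such a
  product by a permutation leaves it unchanged.\<close>

lemma distr_permuted:
  assumes p: "p permutes {1..n}" and n: "1 \<le> n"
  shows "distr M (\<Pi>\<^sub>M i\<in>{1..n}. borel) (\<lambda>\<omega>. \<lambda>i\<in>{1..n}. X (p i) \<omega>)
    = (\<Pi>\<^sub>M i\<in>{1..n}. distr M borel (X 1))"
proof -
  let ?I = "{1..n}" and ?\<mu> = "distr M borel (X 1)"
  have "indep_vars (\<lambda>_. borel) X ?I"
    by (intro indep_vars_subset[OF indep]) auto
  then have "distr M (\<Pi>\<^sub>M i\<in>?I. borel) (\<lambda>\<omega>. \<lambda>i\<in>?I. X i \<omega>)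
    = (\<Pi>\<^sub>M i\<in>?I. distr M borel (X i))"
    using n X_measurable by (subst (asm) indep_vars_iff_distr_eq_PiM') auto
  also have "\<dots> = (\<Pi>\<^sub>M i\<in>?I. ?\<mu>)"
    by (intro PiM_cong ident) auto
  finally have joint: "distr M (\<Pi>\<^sub>M i\<in>?I. borel) (\<lambda>\<omega>. \<lambda>i\<in>?I. X i \<omega>) = (\<Pi>\<^sub>M i\<in>?I. ?\<mu>)" .
  have sets: "sets (\<Pi>\<^sub>M i\<in>?I. ?\<mu>) = sets (\<Pi>\<^sub>M i\<in>?I. borel)"
    by (intro sets_PiM_cong) auto
  have "(\<Pi>\<^sub>M i\<in>?I. ?\<mu>)
    = distr (\<Pi>\<^sub>M i\<in>?I. ?\<mu>) (\<Pi>\<^sub>M i\<in>?I. ?\<mu>) (\<lambda>x. \<lambda>i\<in>?I. x (p i))"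
    using permutes_in_image[OF p] X_measurable
    by (intro distr_PiM_reindex[symmetric] prob_space_distr permutes_inj_on[OF p]) auto
  also have "\<dots> = distr (distr M (\<Pi>\<^sub>M i\<in>?I. borel) (\<lambda>\<omega>. \<lambda>i\<in>?I. X i \<omega>))
      (\<Pi>\<^sub>M i\<in>?I. borel) (\<lambda>x. \<lambda>i\<in>?I. x (p i))"
    unfolding joint by (intro distr_cong sets) auto
  also have "\<dots> = distr M (\<Pi>\<^sub>M i\<in>?I. borel)
      ((\<lambda>x. \<lambda>i\<in>?I. x (p i)) \<circ> (\<lambda>\<omega>. \<lambda>i\<in>?I. X i \<omega>))"
    using permutes_in_image[OF p] X_measurable
    by (intro distr_distr measurable_restrict measurable_component_singleton) auto
  also have "(\<lambda>x. \<lambda>i\<in>?I. x (p i)) \<circ> (\<lambda>\<omega>. \<lambda>i\<in>?I. X i \<omega>) = (\<lambda>\<omega>. \<lambda>i\<in>?I. X (p i) \<omega>)"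
    using permutes_in_image[OF p] by (auto simp: fun_eq_iff)
  finally show ?thesis ..
qed

text \<open>The right-hand side does not mention \<open>p\<close>, so all patterns are equally
  likely. The sample has pattern \<open>p\<close> iff the sample rearranged by \<open>inv p\<close>
  is increasing, and the rearranged sample has the same law.\<close>

lemma prob_pattern:
  assumes p: "p permutes {1..n}" and n: "1 \<le> n"
  shows "\<P>(\<omega> in M. \<forall>i\<in>{1..n}. \<forall>j\<in>{1..n}. X i \<omega> \<le> X j \<omega> \<longleftrightarrow> p i \<le> p j)
    = measure (\<Pi>\<^sub>M i\<in>{1..n}. distr M borel (X 1))
        {x \<in> space (\<Pi>\<^sub>M i\<in>{1..n}. borel). \<forall>i\<in>{1..n}. \<forall>j\<in>{1..n}. x i \<le> x j \<longleftrightarrow> i \<le> j}"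
    (is "_ = measure ?D ?B")
proof -
  let ?q = "inv p"
  have q: "?q permutes {1..n}"
    using p by (rule permutes_inv)
  have q1: "1 \<le> ?q i" if "i \<in> {1..n}" for i
    using permutes_in_image[OF q, of i] that by auto
  \<comment> \<open>Change of variables: \<open>i\<close> and \<open>j\<close> are replaced by their
    images under \<open>p\<close> or \<open>inv p\<close>.\<close>
  have pat: "(\<forall>i\<in>{1..n}. \<forall>j\<in>{1..n}. f i \<le> f j \<longleftrightarrow> p i \<le> p j)
    \<longleftrightarrow> (\<forall>i\<in>{1..n}. \<forall>j\<in>{1..n}. f (?q i) \<le> f (?q j) \<longleftrightarrow> i \<le> j)"
    (is "?L \<longleftrightarrow> ?R") for f :: "nat \<Rightarrow> real"
  proof
    assume L: ?L
    then show ?R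
      using permutes_in_image[OF q] permutes_inverses(1)[OF p] by metis
  next
    assume R: ?R
    then show ?L
      using permutes_in_image[OF p] permutes_inverses(2)[OF p] by metis
  qed
  have "?B \<in> sets (\<Pi>\<^sub>M i\<in>{1..n}. borel)"
    by (intro pred_order_pattern) auto
  moreover have "(\<lambda>\<omega>. \<lambda>i\<in>{1..n}. X (?q i) \<omega>) \<in> M \<rightarrow>\<^sub>M (\<Pi>\<^sub>M i\<in>{1..n}. borel)"
    using X_measurable q1 by (intro measurable_restrict) auto
  ultimately have "measure ?D ?B = prob ((\<lambda>\<omega>. \<lambda>i\<in>{1..n}. X (?q i) \<omega>) -` ?B \<inter> space M)"
    unfolding distr_permuted[OF q n, symmetric] by (rule measure_distr[rotated])
  also have "(\<lambda>\<omega>. \<lambda>i\<in>{1..n}. X (?q i) \<omega>) -` ?B \<inter> space M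
    = {\<omega> \<in> space M. \<forall>i\<in>{1..n}. \<forall>j\<in>{1..n}. X i \<omega> \<le> X j \<omega> \<longleftrightarrow> p i \<le> p j}"
    unfolding pat by (auto simp: space_PiM)
  finally show ?thesis ..
qed

text \<open>Again the right-hand side is free of \<open>r\<close>: every admissible rank vector is
  the rank vector of some permutation \<open>p\<close>, and the event of these ranks is almost
  surely the event of pattern \<open>p\<close>.\<close>

lemma prob_ranks_eq:
  assumes r: "r \<in> (\<Pi>\<^sub>E i\<in>{1..n}. {1..i})" and n: "1 \<le> n"
  shows "\<P>(\<omega> in M. \<forall>i\<in>{1..n}. rank_in (\<lambda>j. X j \<omega>) i = r i)
    = measure (\<Pi>\<^sub>M i\<in>{1..n}. distr M borel (X 1))
        {x \<in> space (\<Pi>\<^sub>M i\<in>{1..n}. borel). \<forall>i\<in>{1..n}. \<forall>j\<in>{1..n}. x i \<le> x j \<longleftrightarrow> i \<le> j}"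
proof -
  obtain p where p: "p permutes {1..n}" and pr: "\<And>i. i \<in> {1..n} \<Longrightarrow> rank_in p i = r i"
    using ex_permutation_with_ranks[OF r] by blast
  have [measurable]: "(\<lambda>\<omega>. rank_in (\<lambda>j. X j \<omega>) i) \<in> M \<rightarrow>\<^sub>M count_space UNIV"
    if "i \<in> {1..n}" for i
    using rank_in_measurable that by auto
  have "\<P>(\<omega> in M. \<forall>i\<in>{1..n}. rank_in (\<lambda>j. X j \<omega>) i = r i)
    = \<P>(\<omega> in M. \<forall>i\<in>{1..n}. \<forall>j\<in>{1..n}. X i \<omega> \<le> X j \<omega> \<longleftrightarrow> p i \<le> p j)"
  proof (rule prob_eq_AE)
    \<comment> \<open>From ranks to pattern the absence of ties is used; from pattern to ranks
      \<open>rank_in_cong\<close> suffices.\<close>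
    show "AE \<omega> in M. (\<forall>i\<in>{1..n}. rank_in (\<lambda>j. X j \<omega>) i = r i)
      \<longleftrightarrow> (\<forall>i\<in>{1..n}. \<forall>j\<in>{1..n}. X i \<omega> \<le> X j \<omega> \<longleftrightarrow> p i \<le> p j)"
      using AE_inj[of n]
    proof eventually_elim
      case (elim \<omega>)
      show ?case
        using same_pattern_if_rank_in_eq[OF elim permutes_inj_on[OF p]]
          rank_in_cong[of n "\<lambda>i. X i \<omega>" p] pr
        by (metis (no_types, lifting))
    qed
    show "{\<omega> \<in> space M. \<forall>i\<in>{1..n}. rank_in (\<lambda>j. X j \<omega>) i = r i} \<in> events"
      by measurable
    show "{\<omega> \<in> space M. \<forall>i\<in>{1..n}. \<forall>j\<in>{1..n}. X i \<omega> \<le> X j \<omega> \<longleftrightarrow> p i \<le> p j} \<in> events"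
      by (intro pred_order_pattern) (auto intro: X_measurable)
  qed
  with prob_pattern[OF p n] show ?thesis by simp
qed

text \<open>Each admissible rank vector has the same probability \<open>c\<close>, so the
  probability of a box is \<open>c\<close> times its number of points; total mass 1 then determines
  \<open>c\<close>.\<close>

lemma prob_ranks_in:
  assumes n: "1 \<le> n"
  shows "\<P>(\<omega> in M. \<forall>i\<in>{1..n}. rank_in (\<lambda>j. X j \<omega>) i \<in> A i)
    = (\<Prod>i = 1..n. real (card (A i \<inter> {1..i})) / real i)"
proof -
  obtain c where c: "\<And>r. r \<in> (\<Pi>\<^sub>E i\<in>{1..n}. {1..i})
      \<Longrightarrow> \<P>(\<omega> in M. \<forall>i\<in>{1..n}. rank_in (\<lambda>j. X j \<omega>) i = r i) = c"
    using prob_ranks_eq n by blast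
  have [measurable]: "(\<lambda>\<omega>. rank_in (\<lambda>j. X j \<omega>) i) \<in> M \<rightarrow>\<^sub>M count_space UNIV"
    if "i \<in> {1..n}" for i
    using rank_in_measurable that by auto
  have *: "\<P>(\<omega> in M. \<forall>i\<in>{1..n}. rank_in (\<lambda>j. X j \<omega>) i \<in> A i)
    = c * (\<Prod>i = 1..n. real (card (A i \<inter> {1..i})))" for A
  proof -
    \<comment> \<open>Cutting down to \<open>{1..i}\<close> makes the box finite and loses no
      outcome, by \<open>rank_in_mem\<close>.\<close>
    let ?S = "\<Pi>\<^sub>E i\<in>{1..n}. A i \<inter> {1..i}"
    let ?E = "\<lambda>r. {\<omega> \<in> space M. \<forall>i\<in>{1..n}. rank_in (\<lambda>j. X j \<omega>) i = r i}"
    have "{\<omega> \<in> space M. \<forall>i\<in>{1..n}. rank_in (\<lambda>j. X j \<omega>) i \<in> A i} = (\<Union>r\<in>?S. ?E r)"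
    proof (intro equalityI subsetI)
      fix \<omega> assume "\<omega> \<in> {\<omega> \<in> space M. \<forall>i\<in>{1..n}. rank_in (\<lambda>j. X j \<omega>) i \<in> A i}"
      then have "restrict (rank_in (\<lambda>j. X j \<omega>)) {1..n} \<in> ?S"
        "\<omega> \<in> ?E (restrict (rank_in (\<lambda>j. X j \<omega>)) {1..n})"
        using rank_in_mem by (fastforce simp: PiE_iff)+
      then show "\<omega> \<in> (\<Union>r\<in>?S. ?E r)"
        by blast
    qed (auto simp: PiE_iff)
    moreover have "prob (\<Union>r\<in>?S. ?E r) = (\<Sum>r\<in>?S. prob (?E r))"
    proof (rule finite_measure_finite_Union)
      show "disjoint_family_on ?E ?S"
        unfolding disjoint_family_on_def
      proof (intro ballI impI)
        fix r s assume "r \<in> ?S" "s \<in> ?S" "r \<noteq> s"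
        then obtain i where "i \<in> {1..n}" "r i \<noteq> s i"
          using PiE_ext by blast
        then show "?E r \<inter> ?E s = {}"
          by auto
      qed
    qed (auto intro: finite_PiE)
    moreover have "(\<Sum>r\<in>?S. prob (?E r)) = (\<Sum>r\<in>?S. c)"
      by (intro sum.cong c) (auto simp: PiE_iff)
    ultimately show ?thesis
      by (simp add: card_PiE)
  qed
  \<comment> \<open>With every \<open>A i\<close> equal to \<open>UNIV\<close> the event is certain,
    and the box is the full product with \<open>fact n\<close> points.\<close>
  have "c * fact n = 1"
    using *[of "\<lambda>_. UNIV"] by (simp add: prob_space fact_prod)
  then have "c = 1 / (\<Prod>i = 1..n. real i)"
    by (simp add: fact_prod field_simps)
  with * show ?thesis
    by (simp add: prod_dividef)
qed

text \<open>The marginal arises by leaving all other coordinates unconstrained: each contributes a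
  factor \<open>k / k = 1\<close>.\<close>

lemma prob_rank_in:
  assumes i: "1 \<le> i"
  shows "\<P>(\<omega> in M. rank_in (\<lambda>j. X j \<omega>) i \<in> A) = real (card (A \<inter> {1..i})) / real i"
proof -
  have "\<P>(\<omega> in M. rank_in (\<lambda>j. X j \<omega>) i \<in> A)
    = \<P>(\<omega> in M. \<forall>k\<in>{1..i}. rank_in (\<lambda>j. X j \<omega>) k \<in> (if k = i then A else UNIV))"
    using i by (intro arg_cong[of _ _ prob]) auto
  also have "\<dots> = (\<Prod>k = 1..i. if k = i then real (card (A \<inter> {1..i})) / real i else 1)"
    unfolding prob_ranks_in[OF i] by (intro prod.cong) auto
  also have "\<dots> = real (card (A \<inter> {1..i})) / real i"
    using i by (simp add: prod.delta)
  finally show ?thesis .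
qed

lemma indep_ranks: "indep_vars (\<lambda>_. count_space UNIV) (\<lambda>i \<omega>. rank_in (\<lambda>j. X j \<omega>) i) {1..n}"
proof (cases "1 \<le> n")
  case True
  show ?thesis
  \<comment> \<open>The generator is the full power set, so the product formula has to hold for
    arbitrary sets \<open>A i\<close>; the two preceding lemmas evaluate both sides.\<close>
  proof (subst indep_vars_finite[where E = "\<lambda>_. UNIV"])
    show "\<forall>A\<in>{1..n} \<rightarrow> UNIV.
      prob (\<Inter>i\<in>{1..n}. (\<lambda>\<omega>. rank_in (\<lambda>j. X j \<omega>) i) -` A i \<inter> space M)
      = (\<Prod>i\<in>{1..n}. prob ((\<lambda>\<omega>. rank_in (\<lambda>j. X j \<omega>) i) -` A i \<inter> space M))"
    proof
      fix A :: "nat \<Rightarrow> nat set"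
      have "(\<Inter>i\<in>{1..n}. (\<lambda>\<omega>. rank_in (\<lambda>j. X j \<omega>) i) -` A i \<inter> space M)
        = {\<omega> \<in> space M. \<forall>i\<in>{1..n}. rank_in (\<lambda>j. X j \<omega>) i \<in> A i}"
        using True by auto
      moreover have "(\<lambda>\<omega>. rank_in (\<lambda>j. X j \<omega>) i) -` A i \<inter> space M
        = {\<omega> \<in> space M. rank_in (\<lambda>j. X j \<omega>) i \<in> A i}" for i
        by auto
      ultimately show "prob (\<Inter>i\<in>{1..n}. (\<lambda>\<omega>. rank_in (\<lambda>j. X j \<omega>) i) -` A i \<inter> space M)
        = (\<Prod>i\<in>{1..n}. prob ((\<lambda>\<omega>. rank_in (\<lambda>j. X j \<omega>) i) -` A i \<inter> space M))"
        by (simp add: prob_ranks_in[OF True] prob_rank_in del: One_nat_def)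
    qed
  qed (use True rank_in_measurable in \<open>auto simp: Int_stable_def sigma_sets_top\<close>)
next
  case False
  then show ?thesis
    by (simp add: indep_vars_def indep_sets_def)
qed

end

section \<open>The standard normal cdf and its quantile\<close>

text \<open>The density is positive everywhere, so an interval that is null for the normal law would
  be Lebesgue null, against its positive length.\<close>

lemma std_normal_cdf_less:
  assumes "x < y"
  shows "std_normal_cdf x < std_normal_cdf y"
proof -
  interpret real_distribution std_normal_distribution
    by (rule real_dist_normal_dist)
  have "emeasure std_normal_distribution {x<..y} \<noteq> 0"
  proof
    assume "emeasure std_normal_distribution {x<..y} = 0"
    moreover have "\<not> std_normal_density z \<le> 0" for z
      by (simp add: not_le normal_density_pos)
    ultimately have "AE z in lborel. z \<notin> {x<..y}"
      by (simp add: emeasure_density nn_integral_0_iff_AE indicator_def ennreal_eq_0_iff)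
    then have "emeasure lborel {x<..y} = 0"
      by (subst (asm) AE_iff_measurable[OF _ refl]) (auto simp: greaterThanAtMost_def Int_def)
    with assms show False by simp
  qed
  then have "0 < measure std_normal_distribution {x<..y}"
    by (simp add: emeasure_eq_measure zero_less_measure_iff)
  then show ?thesis
    using cdf_diff_eq[OF assms] by (simp add: std_normal_cdf_def)
qed

lemma std_normal_cdf_le_iff: "std_normal_cdf x \<le> std_normal_cdf y \<longleftrightarrow> x \<le> y"
  using std_normal_cdf_less by (metis le_less not_le)

lemma isCont_std_normal_cdf: "isCont std_normal_cdf x"
proof -
  interpret real_distribution std_normal_distribution
    by (rule real_dist_normal_dist)
  have "emeasure std_normal_distribution {x} = 0"
    by (subst emeasure_density) (auto simp: nn_integral_0_iff_AE indicator_def intro: AE_lborel_singleton[THEN eventually_mono])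
  then show ?thesis
    by (simp add: std_normal_cdf_def isCont_cdf measure_def)
qed

text \<open>The quantile is defined by \<open>inv\<close>, so it is enough that \<open>p\<close>
  lies in the range of the cdf; this is the intermediate value theorem between points taken from the
  limits 0 and 1.\<close>

lemma std_normal_cdf_quantile:
  assumes "0 < p" "p < 1"
  shows "std_normal_cdf (std_normal_quantile p) = p"
proof -
  interpret real_distribution std_normal_distribution
    by (rule real_dist_normal_dist)
  have "eventually (\<lambda>x. std_normal_cdf x < p) at_bot"
    using order_tendstoD(2)[OF cdf_lim_at_bot assms(1)] by (simp add: std_normal_cdf_def)
  then obtain a where a: "std_normal_cdf a < p"
    by (auto simp: eventually_at_bot_linorder)
  have "eventually (\<lambda>x. p < std_normal_cdf x) at_top"
    using order_tendstoD(1)[OF cdf_lim_at_top_prob assms(2)] by (simp add: std_normal_cdf_def)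
  then obtain b where b: "p < std_normal_cdf b"
    by (auto simp: eventually_at_top_linorder)
  have "a \<le> b"
    using a b std_normal_cdf_le_iff[of a b] by simp
  then have "\<exists>x. a \<le> x \<and> x \<le> b \<and> std_normal_cdf x = p"
    using a b by (intro IVT) (auto intro: isCont_std_normal_cdf)
  then have "p \<in> range std_normal_cdf"
    by auto
  then show ?thesis
    by (simp add: std_normal_quantile_def f_inv_into_f)
qed

section \<open>Limit of the uniform law on midpoints\<close>

text \<open>The \<open>k\<close>-th midpoint is at most \<open>t\<close> iff \<open>k\<close> is at
  most \<open>t * i + 1/2\<close>. The count is thus the floor of that number, which differs from
  \<open>t * i\<close> by at most \<open>1/2\<close>.\<close>

lemma fraction_midpoints_le_tendsto:
  assumes "0 \<le> t" "t \<le> 1"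
  shows "(\<lambda>i. real (card ({k. (real k - 1 / 2) / real i \<le> t} \<inter> {1..i})) / real i) \<longlonglongrightarrow> t"
proof -
  have bound: "\<bar>real (card ({k. (real k - 1 / 2) / real i \<le> t} \<inter> {1..i})) / real i - t\<bar> \<le> 1 / real i"
    if "1 \<le> i" for i
  proof -
    define m where "m = nat \<lfloor>t * real i + 1 / 2\<rfloor>"
    have ti: "0 \<le> t * real i" "t * real i \<le> real i"
      using assms by (auto simp: mult_left_le_one_le)
    then have m: "real m \<le> t * real i + 1 / 2" "t * real i + 1 / 2 < real m + 1"
      unfolding m_def by linarith+
    \<comment> \<open>Since \<open>t\<close> is at most 1, the integer \<open>m\<close> is at most
      \<open>i + 1/2\<close>.\<close>
    with ti have "m \<le> i"
      by linarith
    have "(real k - 1 / 2) / real i \<le> t \<longleftrightarrow> k \<le> m" for k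
    proof -
      have "(real k - 1 / 2) / real i \<le> t \<longleftrightarrow> real k \<le> t * real i + 1 / 2"
        using that by (subst pos_divide_le_eq) auto
      also have "\<dots> \<longleftrightarrow> k \<le> m"
        using m by linarith
      finally show ?thesis .
    qed
    then have "{k. (real k - 1 / 2) / real i \<le> t} = {..m}"
      by (simp only: atMost_def)
    then have "{k. (real k - 1 / 2) / real i \<le> t} \<inter> {1..i} = {..m} \<inter> {1..i}"
      by (rule arg_cong)
    also have "\<dots> = {1..m}"
      using \<open>m \<le> i\<close> by auto
    finally have "{k. (real k - 1 / 2) / real i \<le> t} \<inter> {1..i} = {1..m}" .
    moreover have "real m / real i - t = (real m - t * real i) / real i"
      using that by (simp add: field_simps)
    moreover have "\<bar>real m - t * real i\<bar> / real i \<le> 1 / real i"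
      using m by (intro divide_right_mono) linarith+
    ultimately show ?thesis
      by (simp del: One_nat_def)
  qed
  have "(\<lambda>i. real (card ({k. (real k - 1 / 2) / real i \<le> t} \<inter> {1..i})) / real i - t) \<longlonglongrightarrow> 0"
    by (intro Lim_null_comparison[OF _ lim_1_over_n] eventually_sequentiallyI[of 1])
      (simp only: real_norm_def bound)
  then show ?thesis
    by (rule LIM_zero_cancel)
qed

section \<open>Transfer from ranks to the scores\<close>

theorem mainTheorem1:
  fixes M :: "'a measure" and X :: "nat \<Rightarrow> 'a \<Rightarrow> real" and F :: "real \<Rightarrow> real"
  assumes "prob_space M"
    and "prob_space.indep_vars M (\<lambda>_. borel) X {1..}"
    and "\<And>i. i \<ge> 1 \<Longrightarrow> cdf (distr M borel (X i)) = F"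
    and "continuous_on UNIV F"
  shows "(\<forall>n\<ge>1. prob_space.indep_vars M (\<lambda>_. borel) (rank_score X) {1..n})
    \<and> (\<forall>n\<ge>1. prob_space.indep_vars M (\<lambda>_. borel) (seq_normal_score X) {1..n})
    \<and> weak_conv_m (\<lambda>i. distr M borel (seq_normal_score X i)) std_normal_distribution"
proof -
  interpret prob_space M by fact
  have X: "X i \<in> borel_measurable M" if "1 \<le> i" for i
    using assms(2) that unfolding indep_vars_def by auto
  have rd: "real_distribution (distr M borel (X i))" if "1 \<le> i" for i
    using X[OF that] by (rule real_distribution_distr)
  interpret iid_atomless M X
  proof
    show "distr M borel (X i) = distr M borel (X 1)" if "1 \<le> i" for i
      using that rd assms(3) by (intro cdf_unique) auto
    \<comment> \<open>The mass of a point is the jump of the cdf there, which vanishes for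
      continuous \<open>F\<close>.\<close>
    show "measure (distr M borel (X 1)) {x} = 0" for x
    proof -
      interpret D: real_distribution "distr M borel (X 1)"
        by (rule rd) simp
      show ?thesis
        using assms(3)[of 1] assms(4) D.isCont_cdf[of x] by (simp add: continuous_on_eq_continuous_at)
    qed
  qed (fact assms(2))
  have P: "rank_score X = (\<lambda>i \<omega>. (real (rank_in (\<lambda>j. X j \<omega>) i) - 1 / 2) / real i)"
    by (intro ext) (simp add: rank_score_def seq_rank_eq_rank_in)
  have Z: "seq_normal_score X
    = (\<lambda>i \<omega>. std_normal_quantile ((real (rank_in (\<lambda>j. X j \<omega>) i) - 1 / 2) / real i))"
    by (intro ext) (simp add: seq_normal_score_def P)
  \<comment> \<open>Each score is a function of the rank with the same index alone, so independence
    is inherited. Any function on \<open>count_space UNIV\<close> is measurable.\<close>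
  have "indep_vars (\<lambda>_. borel) (rank_score X) {1..n}" for n
    unfolding P by (rule indep_vars_compose2[OF indep_ranks]) simp
  moreover have "indep_vars (\<lambda>_. borel) (seq_normal_score X) {1..n}" for n
    unfolding Z by (rule indep_vars_compose2[OF indep_ranks]) simp
  moreover have "weak_conv_m (\<lambda>i. distr M borel (seq_normal_score X i)) std_normal_distribution"
    unfolding weak_conv_m_def weak_conv_def
  proof (intro allI impI)
    fix x
    interpret N: real_distribution std_normal_distribution
      by (rule real_dist_normal_dist)
    let ?t = "std_normal_cdf x"
    have cdf_eq: "cdf (distr M borel (seq_normal_score X i)) x
      = real (card ({k. (real k - 1 / 2) / real i \<le> ?t} \<inter> {1..i})) / real i" if i: "1 \<le> i" for i
    proof -
      have "seq_normal_score X i \<in> borel_measurable M"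
        unfolding Z by (rule measurable_compose[OF rank_in_measurable[OF i]]) simp
      then have "cdf (distr M borel (seq_normal_score X i)) x
        = prob (seq_normal_score X i -` {..x} \<inter> space M)"
        by (simp add: cdf_def measure_distr)
      also have "seq_normal_score X i -` {..x} \<inter> space M
        = {\<omega> \<in> space M. rank_in (\<lambda>j. X j \<omega>) i \<in> {k. (real k - 1 / 2) / real i \<le> ?t}}"
      proof -
        have "seq_normal_score X i \<omega> \<le> x
          \<longleftrightarrow> (real (rank_in (\<lambda>j. X j \<omega>) i) - 1 / 2) / real i \<le> ?t" for \<omega>
        proof -
          \<comment> \<open>The rank lies between 1 and \<open>i\<close>, and subtracting
            \<open>1/2\<close> keeps the quotient strictly inside the unit interval, where the
            quantile really inverts the cdf.\<close>
          have "std_normal_cdf (seq_normal_score X i \<omega>)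
            = (real (rank_in (\<lambda>j. X j \<omega>) i) - 1 / 2) / real i"
            unfolding Z using rank_in_mem[OF i, of "\<lambda>j. X j \<omega>"] i
            by (intro std_normal_cdf_quantile) (auto simp: divide_simps)
          then show ?thesis
            by (metis std_normal_cdf_le_iff)
        qed
        then show ?thesis
          by auto
      qed
      also have "prob \<dots> = real (card ({k. (real k - 1 / 2) / real i \<le> ?t} \<inter> {1..i})) / real i"
        by (rule prob_rank_in[OF i])
      finally show ?thesis .
    qed
    have "0 \<le> ?t" "?t \<le> 1"
      using N.cdf_nonneg N.cdf_bounded_prob by (auto simp: std_normal_cdf_def)
    \<comment> \<open>The formula \<open>cdf_eq\<close> holds from index 1 on, which suffices for
      the limit.\<close>
    from fraction_midpoints_le_tendsto[OF this]
    have "(\<lambda>i. cdf (distr M borel (seq_normal_score X i)) x) \<longlonglongrightarrow> ?t"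
      by (rule Lim_transform_eventually) (rule eventually_sequentiallyI[of 1], simp only: cdf_eq)
    then show "(\<lambda>i. cdf (distr M borel (seq_normal_score X i)) x)
      \<longlonglongrightarrow> cdf std_normal_distribution x"
      by (simp add: std_normal_cdf_def)
  qed
  ultimately show ?thesis
    by blast
qed

end
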